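(* For every integer $b\geq 2$, the irrationality exponent of the Cantor number $\xi_{\mathbf{c},b}=\sum_{k\geq 0}\frac{c_k}{b^k}$ is equal to $2$.
   Context: The Cantor sequence $\mathbf{c}=(c_n)_{n\ge 0}\in\{0,1\}^{\mathbb{N}}$ is defined by $c_0=1$, $c_{3n}=c_n$, $c_{3n+1}=0$, $c_{3n+2}=c_n$ for $n\ge 0$ (equivalently, $c_n=1$ if the base-$3$ expansion of $n$ contains no digit $1$, and $c_n=0$ otherwise). The irrationality exponent of an irrational real number $\xi$ is $\mu(\xi)=\sup\{\mu\in\mathbb{R} : |\xi-\frac{p}{q}|<\frac{1}{q^{\mu}} \text{ for infinitely many } (p,q)\in\mathbb{Z}\times\mathbb{N}\}$, where $q\ge 1$. *)

theory Defs
  imports Complex_Main "HOL-Library.Extended_Real"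
begin

fun cantor_seq :: "nat \<Rightarrow> nat" where
  "cantor_seq n =
     (if n = 0 then 1 else if n mod 3 = 1 then 0 else cantor_seq (n div 3))"

declare cantor_seq.simps [simp del] (* the equation is unconditional and loops *)

lemma cantor_seq_rec:
  "cantor_seq 0 = 1"
  "cantor_seq (3 * n) = cantor_seq n"
  "cantor_seq (3 * n + 1) = 0"
  "cantor_seq (3 * n + 2) = cantor_seq n"
proof -
  show 0: "cantor_seq 0 = 1" by (subst cantor_seq.simps) simp
  show "cantor_seq (3 * n) = cantor_seq n"
    by (cases "n = 0") (simp, subst cantor_seq.simps, simp)
  show "cantor_seq (3 * n + 1) = 0"
    by (subst cantor_seq.simps) (simp add: mod_Suc)
  have "(3 * n + 2) mod 3 = 2" "(3 * n + 2) div 3 = n" by presburger+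
  then show "cantor_seq (3 * n + 2) = cantor_seq n"
    by (subst cantor_seq.simps) simp
qed

lemma cantor_seq_le_1: "cantor_seq n \<le> 1"
proof (induction n rule: less_induct)
  case (less n)
  then show ?case
    by (subst cantor_seq.simps) auto
qed

lemma summable_cantor:
  fixes b :: int
  assumes "b \<ge> 2"
  shows "summable (\<lambda>k. real (cantor_seq k) / real_of_int b ^ k)"
proof (rule summable_comparison_test')
  show "summable (\<lambda>k. (1 / real_of_int b) ^ k)"
    using assms by (intro summable_geometric) simp
  show "norm (real (cantor_seq k) / real_of_int b ^ k) \<le> (1 / real_of_int b) ^ k"
    if "k \<ge> 0" for k
    using assms cantor_seq_le_1[of k] by (simp add: power_one_over field_simps)
qed

text \<open>
  The supremum is taken in the extended reals, since the exponent is infinite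
  for Liouville numbers.  The pairs \<open>(p, q)\<close> are not required to be coprime.
\<close>

definition irrationality_exponent :: "real \<Rightarrow> ereal" where
  "irrationality_exponent \<xi> =
     Sup (ereal ` {\<mu>::real. infinite {(p::int, q::nat).
       q \<ge> 1 \<and> \<bar>\<xi> - real_of_int p / real q\<bar> < 1 / real q powr \<mu>}})"

text \<open>
  The definition is total, but a finite value entails irrationality.
\<close>

lemma irrationality_exponent_rational:
  assumes "\<xi> \<in> \<rat>"
  shows "irrationality_exponent \<xi> = \<infinity>"
proof -
  obtain a :: int and d :: nat where d: "d \<noteq> 0" and \<xi>: "\<xi> = real_of_int a / real d"
    using assms by (metis Rats_cases' of_int_of_nat_eq of_nat_0_less_iff
        zero_less_imp_eq_int less_irrefl)
  have inf: "infinite {(p::int, q::nat).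
      q \<ge> 1 \<and> \<bar>\<xi> - real_of_int p / real q\<bar> < 1 / real q powr \<mu>}" (is "infinite ?S") for \<mu>
  proof -
    let ?f = "\<lambda>k. (int (Suc k) * a, Suc k * d)"
    have "inj ?f" using d by (intro injI) (metis Pair_inject mult_right_cancel nat.inject)
    moreover have "range ?f \<subseteq> ?S"
    proof clarify
      fix k
      have "real_of_int (int (Suc k) * a) / real (Suc k * d) = \<xi>"
        unfolding \<xi> using d by (simp add: divide_simps del: of_nat_Suc mult_Suc)
      then show "1 \<le> Suc k * d \<and>
        \<bar>\<xi> - real_of_int (int (Suc k) * a) / real (Suc k * d)\<bar> < 1 / real (Suc k * d) powr \<mu>"
        using d by (simp del: of_nat_Suc mult_Suc)
    qed
    ultimately show ?thesis
      by (meson infinite_super range_inj_infinite)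
  qed
  show ?thesis
    unfolding irrationality_exponent_def
  proof (rule Sup_eqI)
    fix y :: ereal
    assume y: "\<And>z. z \<in> ereal ` {\<mu>. infinite {(p::int, q::nat).
      q \<ge> 1 \<and> \<bar>\<xi> - real_of_int p / real q\<bar> < 1 / real q powr \<mu>}} \<Longrightarrow> z \<le> y"
    have "ereal \<mu> \<le> y" for \<mu>
      using inf by (intro y) blast
    then show "\<infinity> \<le> y"
      by (metis ereal_infty_less_eq(1) ereal_top)
  qed simp
qed

end

theory Submission
  imports Defs "HOL-Analysis.FPS_Convergence" "HOL-Analysis.Kronecker_Approximation_Theorem"
    "HOL-Computational_Algebra.Formal_Laurent_Series"
begin

text \<open>
  The generating series \<open>F\<close> of the Cantor sequence satisfies \<open>F(z) = (1 + z\<^sup>2) F(z\<^sup>3)\<close>, and hence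
  \<open>(1 + z\<^sup>2) F\<^sup>2 \<equiv> 1\<close> modulo 3: modulo 3, \<open>F\<close> is quadratic. Let \<open>Q F - P\<close> be a Pade approximation with
  integer polynomials of degree at most \<open>n\<close>, vanishing to order at least \<open>2n + 1\<close>, and with \<open>Q\<close> primitive.
  Multiplying by the conjugate \<open>Q F + P\<close> gives the polynomial \<open>Q\<^sup>2 - (1 + z\<^sup>2) P\<^sup>2\<close> modulo 3, which has
  degree at most \<open>2n + 2\<close> and is nonzero since \<open>1 + z\<^sup>2\<close> is not a square; so the order of \<open>Q F - P\<close>
  is \<open>2n + 1\<close> or \<open>2n + 2\<close>.

  Evaluating at \<open>z = 1/y\<close> with \<open>y = b^(3^m)\<close> and using the functional equation \<open>m\<close> times yields integers
  \<open>u\<close>, \<open>v\<close> with \<open>\<bar>u\<bar> \<lesssim> y^(n+1)\<close> and \<open>y^(-n-1) \<lesssim> \<bar>u \<xi> - v\<bar> \<lesssim> y^(-n)\<close>. As \<open>m\<close> tends to infinity and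
  \<open>n\<close> ranges over an interval \<open>[N, 3N]\<close>, these approximations are so dense that they force
  \<open>\<bar>\<xi> - p/q\<bar> \<greatersim> q^(-2-6/N)\<close> for all \<open>p/q\<close>, and \<open>N\<close> is arbitrary.
\<close>

unbundle no vec_syntax

section \<open>Pade approximations modulo 3\<close>

lemma prime_elem_const_poly_3: "prime_elem [:3::int:]"
  by (simp add: prime_elem_const_poly_iff)

text \<open>2 is not a square modulo 3. The form arises by evaluating at z = 1, where 1 + z^2 takes
  the value 2.\<close>

lemma three_dvd_of_dvd_square_minus_double:
  fixes p q :: int
  assumes "3 dvd q\<^sup>2 - 2 * p\<^sup>2"
  shows "3 dvd q" "3 dvd p"
proof -
  have "q mod 3 = 0 \<or> q mod 3 = 1 \<or> q mod 3 = 2" "p mod 3 = 0 \<or> p mod 3 = 1 \<or> p mod 3 = 2"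
    by presburger+
  moreover have "((q mod 3)\<^sup>2 - 2 * (p mod 3)\<^sup>2) mod 3 = (q\<^sup>2 - 2 * p\<^sup>2) mod 3"
    by (intro mod_diff_cong mod_mult_cong refl power_mod)
  ultimately have "q mod 3 = 0 \<and> p mod 3 = 0"
    using assms[THEN dvd_imp_mod_0] by (elim disjE) simp_all
  then show "3 dvd q" "3 dvd p"
    by auto
qed

text \<open>
  Descent on the degree of \<open>Q\<close>: since 2 is not a square modulo 3, evaluation at 1 shows that \<open>z - 1\<close>
  divides both \<open>P\<close> and \<open>Q\<close> modulo 3.
\<close>

lemma square_ne_one_plus_square_mod_3:
  fixes P Q :: "int poly"
  assumes "[:3:] dvd Q\<^sup>2 - [:1, 0, 1:] * P\<^sup>2"
  shows "[:3:] dvd Q"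
  using assms
proof (induction "degree Q" arbitrary: P Q rule: less_induct)
  case less
  have "[:3:] dvd r \<Longrightarrow> 3 dvd poly r 1" for r :: "int poly"
    by (auto elim!: dvdE)
  from this[OF less.prems] have "3 dvd (poly Q 1)\<^sup>2 - 2 * (poly P 1)\<^sup>2"
    by (simp add: algebra_simps)
  from three_dvd_of_dvd_square_minus_double[OF this]
  obtain a c where a: "poly Q 1 = 3 * a" and c: "poly P 1 = 3 * c"
    by (auto elim!: dvdE)
  show ?case
  proof (cases "degree Q = 0")
    case True
    then obtain q where "Q = [:q:]"
      by (metis degree_eq_zeroE)
    then show ?thesis
      using a by simp
  next
    case False
    define Q1 P1 X where "Q1 = synthetic_div Q 1" and "P1 = synthetic_div P 1" 
      and "X = [:-1, 1::int:]"
    have Q: "Q = X * Q1 + [:3:] * [:a:]" and P: "P = X * P1 + [:3:] * [:c:]"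
      using synthetic_div_correct'[of 1 Q] synthetic_div_correct'[of 1 P]
      by (simp_all add: Q1_def P1_def X_def a c mult.commute)
    \<comment> \<open>The remainders 3a and 3c contribute only multiples of 3, so modulo 3 the pair
      (\<open>P1\<close>, \<open>Q1\<close>) inherits the hypothesis once X^2 is cancelled.\<close>
    have "Q\<^sup>2 - [:1, 0, 1:] * P\<^sup>2 = X\<^sup>2 * (Q1\<^sup>2 - [:1, 0, 1:] * P1\<^sup>2)
       + [:3:] * (2 * X * Q1 * [:a:] + [:3:] * [:a:]\<^sup>2
           - [:1, 0, 1:] * (2 * X * P1 * [:c:] + [:3:] * [:c:]\<^sup>2))"
      unfolding Q P by algebra
    with less.prems have "[:3:] dvd X\<^sup>2 * (Q1\<^sup>2 - [:1, 0, 1:] * P1\<^sup>2)"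
      by (metis dvd_add_left_iff dvd_triv_left)
    moreover have "\<not> [:3:] dvd X"
      by (auto simp: X_def const_poly_dvd_iff intro!: exI[of _ 0])
    ultimately have "[:3:] dvd Q1\<^sup>2 - [:1, 0, 1:] * P1\<^sup>2"
      by (metis prime_elem_const_poly_3 prime_elem_dvd_mult_iff prime_elem_dvd_power)
    moreover have "degree Q1 < degree Q"
      using False by (simp add: Q1_def degree_synthetic_div)
    ultimately have "[:3:] dvd Q1"
      using less.hyps by blast
    then show ?thesis
      unfolding Q by (intro dvd_add dvd_mult dvd_triv_left)
  qed
qed

section \<open>The generating series modulo 3\<close>

text \<open>The coefficient ring is left open: divisibility by 3 is studied over the integers,
  evaluation over the reals.\<close>

definition cantor_fps :: "'a :: comm_ring_1 fps"
  where "cantor_fps = Abs_fps (\<lambda>n. of_nat (cantor_seq n))"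

lemma cantor_fps_nth [simp]: "cantor_fps $ n = of_nat (cantor_seq n)"
  by (simp add: cantor_fps_def)

text \<open>Sort the coefficients by index modulo 3: the summand 1 supplies the indices 3m, the
  summand z^2 the indices 3m + 2, and nothing lands on 3m + 1.\<close>

lemma cantor_fps_mahler:
  "(cantor_fps :: 'a :: idom fps) = (1 + fps_X ^ 2) * (cantor_fps oo fps_X ^ 3)" (is "_ = ?r")
proof (rule fps_ext)
  fix n :: nat
  have nth: "?r $ k = (if 3 dvd k then of_nat (cantor_seq (k div 3)) else 0)
      + (if k \<ge> 2 \<and> 3 dvd k - 2 then of_nat (cantor_seq ((k - 2) div 3)) else 0)" for k
    by (auto simp: distrib_right fps_X_power_mult_nth fps_nth_compose_X_power)
  have "n = 3 * (n div 3) \<or> n = 3 * (n div 3) + 1 \<or> n = 3 * (n div 3) + 2"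
    by presburger
  then consider m where "n = 3 * m" | m where "n = 3 * m + 1" | m where "n = 3 * m + 2"
    by blast
  then show "cantor_fps $ n = ?r $ n"
  proof cases
    case 1
    \<comment> \<open>Subtraction truncates: for m = 0 the divisibility holds, but the guard
      \<open>k \<ge> 2\<close> excludes that term.\<close>
    moreover have "3 dvd 3 * m - 2 \<longleftrightarrow> 3 * m < 2"
      by presburger
    ultimately show ?thesis
      by (simp add: nth cantor_seq_rec)
  next
    case 2
    moreover have "\<not> 3 dvd 3 * m + 1" "3 dvd 3 * m + 1 - 2 \<longleftrightarrow> 3 * m + 1 < 2"
      by presburger+
    ultimately show ?thesis
      by (simp add: nth cantor_seq_rec del: One_nat_def add_Suc_right add_0_right)
  next
    case 3
    moreover have "\<not> 3 dvd 3 * m + 2"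
      by presburger
    ultimately show ?thesis
      by (simp add: nth cantor_seq_rec del: add_2_eq_Suc')
  qed
qed

text \<open>For A = (1 + z^2) F^2 the functional equation gives A(z) = A(z^3) modulo 3. So a
  coefficient of positive index n vanishes modulo 3 or agrees with the one at n/3, and descent
  leaves only the constant term 1.\<close>

lemma cantor_fps_square_mod_3:
  "\<exists>B :: int fps. (1 + fps_X\<^sup>2) * cantor_fps\<^sup>2 = 1 + fps_const 3 * B"
proof -
  define A :: "int fps" where "A = (1 + fps_X\<^sup>2) * cantor_fps\<^sup>2"
  define G :: "int fps" where "G = cantor_fps oo fps_X ^ 3"
  have comp: "A oo fps_X ^ 3 = (1 + fps_X ^ 6) * G\<^sup>2"
    unfolding A_def G_def
    by (simp add: fps_compose_mult_distrib fps_compose_add_distrib flip: fps_compose_power power_mult)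
  have "cantor_fps = (1 + fps_X\<^sup>2) * G"
    unfolding G_def by (rule cantor_fps_mahler)
  then have "A = (1 + fps_X\<^sup>2) * ((1 + fps_X\<^sup>2) * G)\<^sup>2"
    by (simp only: A_def)
  \<comment> \<open>Frobenius made explicit: (1 + z^2)^3 = 1 + z^6 + 3 (z^2 + z^4).\<close>
  also have "\<dots> = (A oo fps_X ^ 3) + 3 * ((fps_X\<^sup>2 + fps_X ^ 4) * G\<^sup>2)"
    unfolding comp by algebra
  finally have "A $ n = (A oo fps_X ^ 3) $ n + 3 * ((fps_X\<^sup>2 + fps_X ^ 4) * G\<^sup>2) $ n" for n
    by (metis fps_add_nth fps_mult_left_const_nth numeral_fps_const)
  then have step: "3 dvd A $ n - (if 3 dvd n then A $ (n div 3) else 0)" for n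
    by (simp add: fps_nth_compose_X_power)
  have "3 dvd (A - 1) $ n" for n
  proof (induction n rule: less_induct)
    case (less n)
    show ?case
    proof (cases "n = 0")
      case True
      then show ?thesis
        by (simp add: A_def cantor_seq_rec power2_eq_square)
    next
      case False
      show ?thesis
      proof (cases "3 dvd n")
        case True
        with False have "n div 3 < n" "n div 3 \<noteq> 0"
          by (auto elim!: dvdE)
        with less[of "n div 3"] have "3 dvd A $ (n div 3)"
          by simp
        moreover have "3 dvd A $ n - A $ (n div 3)"
          using step[of n] True by simp
        ultimately show ?thesis
          using False by (simp add: dvd_diff_left_iff)
      qed (use step[of n] False in simp)
    qed
  qed
  then have "\<forall>n. \<exists>k. (A - 1) $ n = 3 * k"
    by (simp add: dvd_def)
  then obtain g where "\<And>n. (A - 1) $ n = 3 * g n"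
    by metis
  then have "A - 1 = fps_const 3 * Abs_fps g"
    by (intro fps_ext) simp
  then show ?thesis
    unfolding A_def by (metis add.commute diff_add_cancel)
qed

lemma cantor_approximant_nonvanishing:
  fixes P Q :: "int poly"
  assumes "degree P \<le> n" "degree Q \<le> n" and "\<not> [:3:] dvd Q"
  shows "\<exists>k\<le>2 * n + 2. (fps_of_poly Q * cantor_fps - fps_of_poly P) $ k \<noteq> 0"
proof (rule ccontr)
  define E where "E = fps_of_poly Q * cantor_fps - fps_of_poly P"
  define E' where "E' = (1 + fps_X\<^sup>2) * (fps_of_poly Q * cantor_fps + fps_of_poly P)"
  define R where "R = Q\<^sup>2 - [:1, 0, 1:] * P\<^sup>2"
  assume "\<not> ?thesis"
  then have E: "E $ k = 0" if "k \<le> 2 * n + 2" for k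
    using that by (auto simp: E_def)
  obtain B :: "int fps" where B: "(1 + fps_X\<^sup>2) * cantor_fps\<^sup>2 = 1 + fps_const 3 * B"
    using cantor_fps_square_mod_3 by blast
  have "fps_of_poly [:1, 0, 1:] = (1 + fps_X\<^sup>2 :: int fps)"
    by (simp add: fps_of_poly_pCons power2_eq_square)
  then have "fps_of_poly R = (fps_of_poly Q)\<^sup>2 - (1 + fps_X\<^sup>2) * (fps_of_poly P)\<^sup>2"
    by (simp add: R_def fps_of_poly_diff fps_of_poly_mult fps_of_poly_power)
  \<comment> \<open>The factor 1 + z^2 in the conjugate \<open>E'\<close> turns
    \<open>cantor_fps\<^sup>2\<close> into (1 + z^2) F^2, which is 1 modulo 3. Thus \<open>R\<close>
    is divisible by \<open>E\<close> modulo 3 and vanishes there through order 2n + 2, beyond its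
    degree.\<close>
  also have "\<dots> = E * E' + (fps_of_poly Q)\<^sup>2 * (1 - (1 + fps_X\<^sup>2) * cantor_fps\<^sup>2)"
    unfolding E_def E'_def by algebra
  also have "\<dots> = E * E' - fps_const 3 * ((fps_of_poly Q)\<^sup>2 * B)"
    unfolding B by (simp add: algebra_simps)
  finally have R: "fps_of_poly R = E * E' - fps_const 3 * ((fps_of_poly Q)\<^sup>2 * B)" .
  have "degree (Q\<^sup>2) \<le> 2 * n + 2" "degree ([:1, 0, 1:] * P\<^sup>2) \<le> 2 * n + 2"
    using assms(1,2) degree_power_le[of Q 2] degree_power_le[of P 2]
      degree_mult_le[of "[:1, 0, 1:]" "P\<^sup>2"] by simp_all
  then have deg: "degree R \<le> 2 * n + 2"
    unfolding R_def by (rule degree_diff_le)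
  have "3 dvd coeff R k" for k
  proof (cases "k \<le> 2 * n + 2")
    case True
    then have "(E * E') $ k = 0"
      by (auto simp: fps_mult_nth E)
    then have "coeff R k = 3 * - ((fps_of_poly Q)\<^sup>2 * B) $ k"
      using arg_cong[OF R, of "\<lambda>f. f $ k"] by simp
    then show ?thesis
      by (metis dvd_triv_left)
  next
    case False
    then show ?thesis
      using deg by (simp add: coeff_eq_0)
  qed
  then have "[:3:] dvd R"
    by (simp add: const_poly_dvd_iff)
  then show False
    using square_ne_one_plus_square_mod_3 assms(3) unfolding R_def by blast
qed

section \<open>Existence of integer Pade approximations\<close>

text \<open>There are n equations in n + 1 unknowns. On a large box of nonnegative vectors the
  linear map takes fewer values than there are points; the difference of two points with equal image
  is a solution.\<close>

lemma siegel_pigeonhole: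
  fixes a :: "nat \<Rightarrow> nat \<Rightarrow> nat"
  shows "\<exists>x :: nat \<Rightarrow> int. (\<exists>j\<le>n. x j \<noteq> 0) \<and> (\<forall>i<n. (\<Sum>j\<le>n. int (a i j) * x j) = 0)"
proof -
  define S where "S = (\<Sum>i<n. \<Sum>j\<le>n. a i j)"
  \<comment> \<open>\<open>S\<close> bounds every row sum, so there are at most (SH + 1)^n images.
    This is at most (S + 1)^n H^n, and H > (S + 1)^n makes it smaller than the H^(n + 1) points of
    the box.\<close>
  define H where "H = (S + 1) ^ n + 1"
  define h where "h = (\<lambda>x :: nat \<Rightarrow> nat. \<lambda>i\<in>{..<n}. \<Sum>j\<le>n. a i j * x j)"
  define V where "V = ({..n} \<rightarrow>\<^sub>E {..<H})"
  have H: "H \<ge> 1"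
    by (simp add: H_def)
  have "h ` V \<subseteq> ({..<n} \<rightarrow>\<^sub>E {..<S * H + 1})"
  proof (clarsimp simp: V_def h_def)
    fix x i assume x: "x \<in> {..n} \<rightarrow>\<^sub>E {..<H}" and i: "i < n"
    have "(\<Sum>j\<le>n. a i j * x j) \<le> (\<Sum>j\<le>n. a i j * H)"
      using x by (intro sum_mono mult_left_mono) (auto simp: PiE_iff less_imp_le)
    also have "\<dots> = (\<Sum>j\<le>n. a i j) * H"
      by (simp add: sum_distrib_right)
    also have "\<dots> \<le> S * H"
      unfolding S_def using i by (intro mult_right_mono member_le_sum) auto
    finally show "(\<Sum>j\<le>n. a i j * x j) < Suc (S * H)"
      by simp
  qed
  then have "card (h ` V) \<le> card ({..<n} \<rightarrow>\<^sub>E {..<S * H + 1})"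
    by (intro card_mono finite_PiE) auto
  also have "\<dots> = (S * H + 1) ^ n"
    by (simp add: card_funcsetE)
  also have "\<dots> \<le> ((S + 1) * H) ^ n"
    using H by (intro power_mono) auto
  also have "\<dots> < H ^ (n + 1)"
  proof -
    have "(S + 1) ^ n * H ^ n < H * H ^ n"
      by (intro mult_strict_right_mono) (auto simp: H_def)
    then show ?thesis
      by (simp only: power_mult_distrib power_add power_one_right mult.commute)
  qed
  also have "\<dots> = card V"
    by (simp add: V_def card_funcsetE)
  finally have "\<not> inj_on h V"
    by (rule pigeonhole)
  then obtain x y where xy: "x \<in> V" "y \<in> V" "h x = h y" "x \<noteq> y"
    by (auto simp: inj_on_def)
  then obtain j where j: "j \<le> n" "x j \<noteq> y j"
    unfolding V_def by (metis PiE_ext atMost_iff)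
  have "(\<Sum>j\<le>n. int (a i j) * (int (x j) - int (y j))) = 0" if "i < n" for i
  proof -
    have "(\<Sum>j\<le>n. a i j * x j) = (\<Sum>j\<le>n. a i j * y j)"
      using fun_cong[OF xy(3), of i] that by (simp add: h_def)
    then have "(\<Sum>j\<le>n. int (a i j) * int (x j)) = (\<Sum>j\<le>n. int (a i j) * int (y j))"
      by (metis (mono_tags, lifting) of_nat_mult of_nat_sum sum.cong)
    then show ?thesis
      by (simp add: right_diff_distrib sum_subtractf)
  qed
  then show ?thesis
    using j by (intro exI[of _ "\<lambda>j. int (x j) - int (y j)"]) auto
qed

text \<open>Only the coefficients n + 1 to 2n of Q F have to be killed, which is n linear conditions
  on the n + 1 coefficients of Q; P then absorbs the orders up to n.\<close>

lemma cantor_pade: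
  "\<exists>P Q :: int poly. degree P \<le> n \<and> degree Q \<le> n \<and> \<not> [:3:] dvd Q \<and>
     (\<forall>k\<le>2 * n. (fps_of_poly Q * cantor_fps - fps_of_poly P) $ k = 0)"
proof -
  obtain x :: "nat \<Rightarrow> int" where x: "\<exists>j\<le>n. x j \<noteq> 0"
    and eq: "\<And>i. i < n \<Longrightarrow> (\<Sum>j\<le>n. int (cantor_seq (n + 1 + i - j)) * x j) = 0"
    using siegel_pigeonhole[of n "\<lambda>i j. cantor_seq (n + 1 + i - j)"] by blast
  define Q0 where "Q0 = (\<Sum>j\<le>n. monom (x j) j)"
  have coeff_Q0: "coeff Q0 j = (if j \<le> n then x j else 0)" for j
    by (simp add: Q0_def coeff_sum)
  \<comment> \<open>Dividing by the content keeps the equations and guarantees that 3 does not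
    divide \<open>Q\<close>.\<close>
  define Q where "Q = primitive_part Q0"
  define c where "c = Polynomial.content Q0"
  have Q0: "Q0 = smult c Q"
    by (simp add: Q_def c_def)
  have "Q0 \<noteq> 0"
    using x coeff_Q0 by (metis coeff_0)
  then have c: "c \<noteq> 0" and content: "Polynomial.content Q = 1"
    by (auto simp: Q_def c_def)
  have degQ: "degree Q \<le> n"
    using coeff_Q0 by (intro degree_le) (metis Q0 c coeff_smult leD mult_eq_0_iff)
  define P where "P = (\<Sum>k\<le>n. monom ((fps_of_poly Q * cantor_fps) $ k) k)"
  have coeff_P: "coeff P k = (if k \<le> n then (fps_of_poly Q * cantor_fps) $ k else 0)" for k
    by (simp add: P_def coeff_sum)
  show ?thesis
  proof (intro exI conjI allI impI)
    show "degree P \<le> n"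
      by (intro degree_le) (simp add: coeff_P)
    show "degree Q \<le> n"
      by fact
    show "\<not> [:3:] dvd Q"
      by (simp add: const_poly_dvd_iff_dvd_content content)
    fix k assume k: "k \<le> 2 * n"
    show "(fps_of_poly Q * cantor_fps - fps_of_poly P) $ k = 0"
    proof (cases "k \<le> n")
      case True
      then show ?thesis
        by (simp add: coeff_P)
    next
      case False
      define i where "i = k - (n + 1)"
      have i: "i < n" "k = n + 1 + i"
        using k False by (auto simp: i_def)
      have "c * (fps_of_poly Q * cantor_fps) $ k = (\<Sum>j=0..k. coeff Q0 j * int (cantor_seq (k - j)))"
        by (simp add: fps_mult_nth Q0 sum_distrib_left mult.assoc)
      also have "\<dots> = (\<Sum>j\<le>n. coeff Q0 j * int (cantor_seq (k - j)))"
        using False by (intro sum.mono_neutral_right) (auto simp: coeff_Q0)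
      also have "\<dots> = (\<Sum>j\<le>n. int (cantor_seq (n + 1 + i - j)) * x j)"
        using i by (intro sum.cong) (auto simp: coeff_Q0)
      also have "\<dots> = 0"
        using eq i by blast
      finally show ?thesis
        using c False by (simp add: coeff_P)
    qed
  qed
qed

section \<open>Analytic estimates\<close>

text \<open>Defined through \<open>eval_fps\<close> so that products, differences and shifts of
  series can be evaluated by the library rules.\<close>

definition cantor_fun :: "real \<Rightarrow> real"
  where "cantor_fun = eval_fps cantor_fps"

lemma summable_cantor_powser:
  assumes "\<bar>x\<bar> < (1::real)"
  shows "summable (\<lambda>k. real (cantor_seq k) * x ^ k)"
proof (rule summable_comparison_test')
  show "summable (\<lambda>k. \<bar>x\<bar> ^ k)"
    using assms by (simp add: summable_geometric)
  show "norm (real (cantor_seq k) * x ^ k) \<le> \<bar>x\<bar> ^ k" if "k \<ge> 0" for k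
    using cantor_seq_le_1[of k] by (simp add: abs_mult power_abs mult_left_le_one_le)
qed

lemma fps_conv_radius_cantor_fps: "fps_conv_radius (cantor_fps :: real fps) \<ge> 1"
  unfolding fps_conv_radius_def
  by (rule conv_radius_geI_ex') (simp add: summable_cantor_powser)

lemma norm_less_conv_radius_cantor_fps:
  "\<bar>x :: real\<bar> < 1 \<Longrightarrow> ereal (norm x) < fps_conv_radius (cantor_fps :: real fps)"
  by (rule order_less_le_trans[OF _ fps_conv_radius_cantor_fps]) (simp add: one_ereal_def)

lemma cantor_fun_sums:
  assumes "\<bar>x\<bar> < 1"
  shows "(\<lambda>k. real (cantor_seq k) * x ^ k) sums cantor_fun x"
  using sums_eval_fps[OF norm_less_conv_radius_cantor_fps[OF assms]] by (simp add: cantor_fun_def)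

lemma cantor_fun_bounds:
  assumes "0 \<le> x" "x \<le> 1 / 2"
  shows "1 \<le> cantor_fun x" "cantor_fun x \<le> 2"
proof -
  have x: "\<bar>x\<bar> < 1"
    using assms by simp
  have "(\<Sum>k\<in>{0}. real (cantor_seq k) * x ^ k) \<le> cantor_fun x"
    using sums_unique[OF cantor_fun_sums[OF x]] summable_cantor_powser[OF x] assms
    by (simp only:) (intro sum_le_suminf, auto)
  then show "1 \<le> cantor_fun x"
    by (simp add: cantor_seq_rec)
  have "cantor_fun x \<le> 1 / (1 - x)"
  proof (rule sums_le)
    show "(\<lambda>k. real (cantor_seq k) * x ^ k) sums cantor_fun x"
      by (rule cantor_fun_sums[OF x])
    show "(\<lambda>k. x ^ k) sums (1 / (1 - x))"
      using x by (intro geometric_sums) simp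
    show "real (cantor_seq k) * x ^ k \<le> x ^ k" for k
      using cantor_seq_le_1[of k] assms by (simp add: mult_left_le_one_le)
  qed
  also have "\<dots> \<le> 2"
    using assms by (simp add: field_simps)
  finally show "cantor_fun x \<le> 2" .
qed

lemma cantor_fun_mahler:
  assumes "\<bar>x\<bar> < 1"
  shows "cantor_fun x = (1 + x\<^sup>2) * cantor_fun (x ^ 3)"
proof -
  have "\<bar>x ^ 3\<bar> < 1"
    using assms by (simp add: power_abs power_less_one_iff)
  then have "(\<lambda>n. (1 + x\<^sup>2) * (real (cantor_seq n) * (x ^ 3) ^ n)) sums
      ((1 + x\<^sup>2) * cantor_fun (x ^ 3))"
    by (intro sums_mult cantor_fun_sums)
  moreover have "(\<lambda>n. \<Sum>k=n * 3..<n * 3 + 3. real (cantor_seq k) * x ^ k) sums cantor_fun x"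
    using sums_group[OF cantor_fun_sums[OF assms], of 3] by simp
  moreover have "(\<Sum>k=n * 3..<n * 3 + 3. real (cantor_seq k) * x ^ k)
      = (1 + x\<^sup>2) * (real (cantor_seq n) * (x ^ 3) ^ n)" for n
  proof -
    have "{n * 3..<n * 3 + 3} = {3 * n, 3 * n + 1, 3 * n + 2}"
      by auto
    then have "(\<Sum>k=n * 3..<n * 3 + 3. real (cantor_seq k) * x ^ k) =
        real (cantor_seq (3 * n)) * x ^ (3 * n) + real (cantor_seq (3 * n + 1)) * x ^ (3 * n + 1)
         + real (cantor_seq (3 * n + 2)) * x ^ (3 * n + 2)"
      by simp
    also have "\<dots> = (1 + x\<^sup>2) * (real (cantor_seq n) * (x ^ 3) ^ n)"
      unfolding cantor_seq_rec by (simp add: power_add algebra_simps power2_eq_square flip: power_mult)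
    finally show ?thesis .
  qed
  ultimately show ?thesis
    using sums_unique2 by simp
qed

text \<open>The series Q F - P has order r equal to 2n + 1 or 2n + 2, so near 0 it behaves like x^r
  times a nonzero integer. The two possible orders account for the different exponents in the
  bounds.\<close>

lemma cantor_pade_asymptotics:
  obtains P Q :: "int poly" and C :: real
  where "degree P \<le> n" "degree Q \<le> n" "C > 0"
    "\<forall>\<^sub>F x in at_right 0. \<bar>poly (map_poly of_int Q) x\<bar> \<le> C \<and>
       x ^ (2 * n + 2) / C \<le> \<bar>poly (map_poly of_int Q) x * cantor_fun x - poly (map_poly of_int P) x\<bar> \<and>
       \<bar>poly (map_poly of_int Q) x * cantor_fun x - poly (map_poly of_int P) x\<bar> \<le> C * x ^ (2 * n + 1)"
proof -
  obtain P Q :: "int poly" where deg: "degree P \<le> n" "degree Q \<le> n" and "\<not> [:3:] dvd Q"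
    and zero: "\<And>k. k \<le> 2 * n \<Longrightarrow> (fps_of_poly Q * cantor_fps - fps_of_poly P) $ k = 0"
    using cantor_pade[of n] by blast
  define Q' P' :: "real poly" where "Q' = map_poly of_int Q" and "P' = map_poly of_int P"
  define D where "D = fps_of_poly Q' * cantor_fps - fps_of_poly P'"
  have D_nth: "D $ k = of_int ((fps_of_poly Q * cantor_fps - fps_of_poly P) $ k)" for k
    by (simp add: D_def Q'_def P'_def coeff_map_poly fps_mult_nth)
  define r where "r = subdegree D"
  obtain j where j: "j \<le> 2 * n + 2" "D $ j \<noteq> 0"
    using cantor_approximant_nonvanishing[OF deg \<open>\<not> [:3:] dvd Q\<close>] D_nth by auto
  then have "r \<le> 2 * n + 2"
    unfolding r_def by (meson order_trans subdegree_leI)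
  moreover have "r \<ge> 2 * n + 1"
    unfolding r_def
  proof (rule subdegree_geI)
    show "D \<noteq> 0"
      using j by auto
    show "D $ k = 0" if "k < 2 * n + 1" for k
      unfolding D_nth using zero[of k] that by (simp del: fps_sub_nth)
  qed
  ultimately have r: "r \<in> {2 * n + 1, 2 * n + 2}"
    by auto
  define h where "h = eval_fps (fps_shift r D)"
  have rad: "ereal (norm x) < fps_conv_radius D" if "\<bar>x\<bar> < 1" for x :: real
  proof -
    have "ereal (norm x) < 1"
      using that by (simp add: one_ereal_def)
    also have "1 \<le> min (min \<infinity> (fps_conv_radius (cantor_fps :: real fps))) \<infinity>"
      using fps_conv_radius_cantor_fps by simp
    also have "\<dots> \<le> min (fps_conv_radius (fps_of_poly Q' * cantor_fps)) \<infinity>"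
      using fps_conv_radius_mult[of "fps_of_poly Q'" cantor_fps] by (intro min.mono) auto
    also have "\<dots> \<le> fps_conv_radius D"
      using fps_conv_radius_diff[of "fps_of_poly Q' * cantor_fps" "fps_of_poly P'"]
      unfolding D_def by simp
    finally show ?thesis .
  qed
  have eval: "poly Q' x * cantor_fun x - poly P' x = x ^ r * h x" if x: "0 < x" "x < 1" for x
  proof -
    have x': "\<bar>x\<bar> < 1"
      using x by simp
    have "ereal (norm x) < fps_conv_radius (fps_of_poly Q' * cantor_fps)"
      using fps_conv_radius_mult[of "fps_of_poly Q'" cantor_fps] norm_less_conv_radius_cantor_fps[OF x']
      by (simp add: order_less_le_trans)
    then have "eval_fps D x = poly Q' x * cantor_fun x - poly P' x"
      unfolding D_def cantor_fun_def using norm_less_conv_radius_cantor_fps[OF x']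
      by (simp add: eval_fps_diff eval_fps_mult)
    moreover have "h x = eval_fps D x / x ^ r"
      unfolding h_def using rad[OF x'] x by (subst eval_fps_shift) (auto simp: r_def)
    ultimately show ?thesis
      using x by simp
  qed
  have "isCont h 0"
    unfolding h_def using rad[of 0, OF order_le_less_trans[OF _ zero_less_one]]
    by (intro continuous_on_interior[OF continuous_on_eval_fps]) (simp add: interior_open)
  then have lim: "(h \<longlongrightarrow> h 0) (at_right 0)"
    by (simp add: isCont_def filterlim_at_split)
  have "h 0 = D $ r"
    by (simp add: h_def eval_fps_at_0)
  moreover have "D $ r \<noteq> 0"
    unfolding r_def using j by auto
  \<comment> \<open>The leading coefficient is a nonzero integer.\<close>
  ultimately have "\<bar>h 0\<bar> \<ge> 1"
    by (simp add: D_nth del: of_int_diff fps_sub_nth)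
  \<comment> \<open>The 2 yields 1/C \<le> 1/2, below |h x| near 0; the margins + 1 make the upper
    bounds strict at 0, hence valid nearby.\<close>
  define C where "C = max 2 (max (\<bar>h 0\<bar> + 1) (\<bar>poly Q' 0\<bar> + 1))"
  have C: "C \<ge> 2" "C \<ge> \<bar>h 0\<bar> + 1" "C \<ge> \<bar>poly Q' 0\<bar> + 1"
    by (auto simp: C_def)
  have "(poly Q' \<longlongrightarrow> poly Q' 0) (at_right 0)"
    by (intro tendsto_intros)
  then have "\<forall>\<^sub>F x in at_right 0. \<bar>poly Q' x\<bar> < C"
    using C by (intro order_tendstoD(2)[OF tendsto_rabs]) auto
  moreover have "\<forall>\<^sub>F x in at_right 0. \<bar>h x\<bar> < C"
    using C lim by (intro order_tendstoD(2)[OF tendsto_rabs]) auto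
  moreover have "\<forall>\<^sub>F x in at_right 0. \<bar>h x\<bar> > 1 / 2"
    using \<open>\<bar>h 0\<bar> \<ge> 1\<close> lim by (intro order_tendstoD(1)[OF tendsto_rabs]) auto
  moreover have "\<forall>\<^sub>F x :: real in at_right 0. x < 1"
    by (rule eventually_at_rightI[of 0 1]) auto
  moreover have "\<forall>\<^sub>F x :: real in at_right 0. x > 0"
    by (rule eventually_at_right_less)
  ultimately have "\<forall>\<^sub>F x in at_right 0. \<bar>poly Q' x\<bar> \<le> C \<and>
      x ^ (2 * n + 2) / C \<le> \<bar>poly Q' x * cantor_fun x - poly P' x\<bar> \<and>
      \<bar>poly Q' x * cantor_fun x - poly P' x\<bar> \<le> C * x ^ (2 * n + 1)"
  proof eventually_elim
    case (elim x)
    have "x ^ (2 * n + 2) \<le> x ^ r" "x ^ r \<le> x ^ (2 * n + 1)"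
      using elim r by (intro power_decreasing; auto)+
    moreover have "1 / C \<le> 1 / 2"
      using C(1) by (simp add: field_simps)
    then have "1 / C \<le> \<bar>h x\<bar>"
      using elim by linarith
    ultimately have "x ^ (2 * n + 2) * (1 / C) \<le> x ^ r * \<bar>h x\<bar>" "x ^ r * \<bar>h x\<bar> \<le> x ^ (2 * n + 1) * C"
      using elim C(1) by (intro mult_mono; simp)+
    moreover have "\<bar>poly Q' x * cantor_fun x - poly P' x\<bar> = x ^ r * \<bar>h x\<bar>"
      using eval[of x] elim by (simp add: abs_mult)
    ultimately show ?case
      using elim by (simp add: mult.commute[of C])
  qed
  with deg C show ?thesis
    by (intro that[of P Q C]) (simp_all add: Q'_def P'_def)
qed

section \<open>Integer linear forms in the Cantor number\<close>

lemma poly_reciprocal_integer: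
  fixes Q :: "int poly" and y :: int
  assumes "degree Q \<le> n" "y \<noteq> 0"
  shows "\<exists>z::int. real_of_int z = real_of_int y ^ n * poly (map_poly of_int Q) (1 / real_of_int y)"
proof
  have "degree (map_poly real_of_int Q) \<le> n"
    using assms(1) by (intro degree_le) (simp add: coeff_map_poly coeff_eq_0)
  then have "poly (map_poly of_int Q) (1 / real_of_int y) = (\<Sum>i\<le>n. of_int (coeff Q i) * (1 / real_of_int y) ^ i)"
    by (subst poly_as_sum_of_monoms'[symmetric]) (auto simp: poly_sum poly_monom coeff_map_poly)
  also have "real_of_int y ^ n * \<dots> = (\<Sum>i\<le>n. of_int (coeff Q i * y ^ (n - i)))"
    unfolding sum_distrib_left
  proof (intro sum.cong refl)
    fix i assume "i \<in> {..n}"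
    then have "real_of_int y ^ n = of_int y ^ (n - i) * of_int y ^ i"
      by (simp flip: power_add)
    then show "real_of_int y ^ n * (of_int (coeff Q i) * (1 / of_int y) ^ i) = of_int (coeff Q i * y ^ (n - i))"
      using assms(2) by (simp add: power_one_over)
  qed
  finally show "real_of_int (\<Sum>i\<le>n. coeff Q i * y ^ (n - i))
      = real_of_int y ^ n * poly (map_poly of_int Q) (1 / real_of_int y)"
    by simp
qed

text \<open>One may take A = b times the product of b^(2 * 3^i) + 1 over i < m: each use of the
  functional equation at y = b^(3^i) costs a factor y^2 as denominator, and y^2 * y = y^3 is the
  next power.\<close>

lemma cantor_number_iterated:
  fixes b :: int
  assumes "b \<ge> 2"
  shows "\<exists>A::int. real_of_int b ^ 3 ^ m * cantor_fun (1 / b) = A * cantor_fun (1 / b ^ 3 ^ m)"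
proof (induction m)
  case 0
  show ?case
    by auto
next
  case (Suc m)
  define y where "y = b ^ 3 ^ m"
  have y: "y \<ge> 2"
    using assms unfolding y_def by (metis dual_order.trans one_le_numeral one_le_power self_le_power zero_less_numeral zero_less_power)
  obtain A :: int where A: "real_of_int b ^ 3 ^ m * cantor_fun (1 / b) = A * cantor_fun (1 / b ^ 3 ^ m)"
    using Suc by blast
  have "cantor_fun (1 / y) = (1 + (1 / y)\<^sup>2) * cantor_fun (1 / y ^ 3)"
    using cantor_fun_mahler[of "1 / y"] y by (simp add: power_one_over)
  moreover have "real_of_int y ^ 3 * cantor_fun (1 / b) = (real_of_int y)\<^sup>2 * (A * cantor_fun (1 / y))"
    using A by (simp add: y_def power3_eq_cube power2_eq_square)
  ultimately have "real_of_int y ^ 3 * cantor_fun (1 / b)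
      = real_of_int (A * (y\<^sup>2 + 1)) * cantor_fun (1 / real_of_int y ^ 3)"
    using y by (simp add: field_simps)
  moreover have "b ^ 3 ^ Suc m = y ^ 3"
    by (simp add: y_def mult.commute flip: power_mult)
  ultimately show ?case
    by (metis of_int_power)
qed

lemma filterlim_tower_at_top:
  fixes b :: int
  assumes b: "b \<ge> 2"
  shows "filterlim (\<lambda>m. real_of_int b ^ 3 ^ m) at_top sequentially"
proof (rule filterlim_at_top_mono[OF filterlim_real_sequentially], rule always_eventually, rule allI)
  fix m :: nat
  have "real m \<le> 2 ^ m"
    using of_nat_less_two_power[of m, where 'a = real] by simp
  also have "\<dots> \<le> 2 ^ 3 ^ m"
    by (intro power_increasing) (simp_all add: self_le_power less_imp_le)
  also have "\<dots> \<le> real_of_int b ^ 3 ^ m"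
    using b by (intro power_mono) simp_all
  finally show "real m \<le> real_of_int b ^ 3 ^ m" .
qed

text \<open>The Pade forms are evaluated at x = 1/y with y = b^(3^m) and cleared of denominators.
  The constant depends on n but not on m.\<close>

lemma cantor_number_approximants:
  fixes b :: int
  assumes b: "b \<ge> 2"
  shows "\<exists>C>0. \<forall>\<^sub>F m in sequentially. \<exists>u v :: int.
     \<bar>real_of_int u\<bar> \<le> C * (real_of_int b ^ 3 ^ m) ^ (n + 1) \<and>
     1 / (C * (real_of_int b ^ 3 ^ m) ^ (n + 1)) \<le> \<bar>u * cantor_fun (1 / b) - v\<bar> \<and>
     \<bar>u * cantor_fun (1 / b) - v\<bar> \<le> C / (real_of_int b ^ 3 ^ m) ^ n"
proof -
  define \<xi> where "\<xi> = cantor_fun (1 / b)"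
  obtain P Q :: "int poly" and C :: real where deg: "degree P \<le> n" "degree Q \<le> n" and C: "C > 0"
    and ev: "\<forall>\<^sub>F x in at_right 0. \<bar>poly (map_poly of_int Q) x\<bar> \<le> C \<and>
       x ^ (2 * n + 2) / C \<le> \<bar>poly (map_poly of_int Q) x * cantor_fun x - poly (map_poly of_int P) x\<bar> \<and>
       \<bar>poly (map_poly of_int Q) x * cantor_fun x - poly (map_poly of_int P) x\<bar> \<le> C * x ^ (2 * n + 1)"
    by (rule cantor_pade_asymptotics[of n])
  have "filterlim (\<lambda>m. 1 / real_of_int b ^ 3 ^ m) (at_right 0) sequentially"
    unfolding inverse_eq_divide[symmetric] 
    by (rule filterlim_compose[OF filterlim_inverse_at_right_top filterlim_tower_at_top[OF b]])
  from eventually_compose_filterlim[OF ev this]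
  have "\<forall>\<^sub>F m in sequentially. \<exists>u v :: int.
     \<bar>real_of_int u\<bar> \<le> (2 * C) * (real_of_int b ^ 3 ^ m) ^ (n + 1) \<and>
     1 / ((2 * C) * (real_of_int b ^ 3 ^ m) ^ (n + 1)) \<le> \<bar>u * \<xi> - v\<bar> \<and>
     \<bar>u * \<xi> - v\<bar> \<le> (2 * C) / (real_of_int b ^ 3 ^ m) ^ n"
  proof eventually_elim
    case (elim m)
    define y where "y = b ^ 3 ^ m"
    define x where "x = 1 / real_of_int y"
    define e where "e = poly (map_poly of_int Q) x * cantor_fun x - poly (map_poly of_int P) x"
    have y: "y \<ge> 2"
      using b unfolding y_def by (metis dual_order.trans one_le_numeral one_le_power self_le_power zero_less_numeral zero_less_power)
    have e: "\<bar>poly (map_poly of_int Q) x\<bar> \<le> C" "x ^ (2 * n + 2) / C \<le> \<bar>e\<bar>" "\<bar>e\<bar> \<le> C * x ^ (2 * n + 1)"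
      using elim by (simp_all add: x_def y_def e_def)
    obtain A :: int where A: "y * \<xi> = A * cantor_fun x"
      using cantor_number_iterated[OF b, of m] by (auto simp: \<xi>_def x_def y_def)
    have f: "1 \<le> cantor_fun x" "cantor_fun x \<le> 2" and \<xi>: "1 \<le> \<xi>" "\<xi> \<le> 2"
      unfolding \<xi>_def x_def by (rule cantor_fun_bounds; use b y in simp)+
    have A_pos: "real_of_int A > 0"
      using A f \<xi> y by (metis less_le_trans mult_pos_pos of_int_0_less_iff zero_less_mult_pos2 zero_less_numeral zero_less_one)
    \<comment> \<open>Both \<xi> and F(x) lie in [1, 2], so A is y up to a factor 2; this is where
      2C comes from.\<close>
    have "real_of_int y \<le> y * \<xi>" "y * \<xi> \<le> real_of_int y * 2"
      "real_of_int A \<le> A * cantor_fun x" "A * cantor_fun x \<le> real_of_int A * 2"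
      using f \<xi> y A_pos by simp_all
    then have A_bounds: "y / 2 \<le> real_of_int A" "A \<le> 2 * real_of_int y"
      using A by linarith+
    obtain q where q: "real_of_int q = real_of_int y ^ n * poly (map_poly of_int Q) x"
      using poly_reciprocal_integer[OF deg(2), of y] y unfolding x_def by auto
    obtain p where p: "real_of_int p = real_of_int y ^ n * poly (map_poly of_int P) x"
      using poly_reciprocal_integer[OF deg(1), of y] y unfolding x_def by auto
    \<comment> \<open>With u = yq and v = Ap, the relation y \<xi> = A F(x) turns the linear form
      into A y^n e.\<close>
    have "(y * q) * \<xi> - A * p = real_of_int y ^ n * (poly (map_poly of_int Q) x * (y * \<xi>) - A * poly (map_poly of_int P) x)"
      by (simp add: p q algebra_simps)
    also have "\<dots> = A * (real_of_int y ^ n * e)"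
      unfolding A e_def by (simp add: algebra_simps)
    finally have "\<bar>(y * q) * \<xi> - A * p\<bar> = A * (real_of_int y ^ n * \<bar>e\<bar>)"
      using A_pos y by (simp add: abs_mult)
    moreover have "A * (real_of_int y ^ n * \<bar>e\<bar>) \<le> 2 * real_of_int y * (real_of_int y ^ n * (C * x ^ (2 * n + 1)))"
      using A_bounds e A_pos y by (intro mult_mono) auto
    moreover have "y / 2 * (real_of_int y ^ n * (x ^ (2 * n + 2) / C)) \<le> A * (real_of_int y ^ n * \<bar>e\<bar>)"
      using A_bounds e A_pos y C by (intro mult_mono) (auto simp: x_def)
    moreover have "2 * real_of_int y * (real_of_int y ^ n * (C * x ^ (2 * n + 1))) = 2 * C / real_of_int y ^ n"
      using y by (simp add: x_def power_one_over power_add power_mult power2_eq_square field_simps)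
    moreover have "y / 2 * (real_of_int y ^ n * (x ^ (2 * n + 2) / C)) = 1 / ((2 * C) * real_of_int y ^ (n + 1))"
      using y C by (simp add: x_def power_one_over power_add power_mult power2_eq_square field_simps)
    moreover have "\<bar>real_of_int (y * q)\<bar> \<le> 2 * C * real_of_int y ^ (n + 1)"
    proof -
      have "\<bar>real_of_int (y * q)\<bar> = real_of_int y ^ (n + 1) * \<bar>poly (map_poly of_int Q) x\<bar>"
        using y by (simp add: q abs_mult)
      also have "\<dots> \<le> real_of_int y ^ (n + 1) * (2 * C)"
        using e C y by (intro mult_left_mono) auto
      finally show ?thesis
        by (simp add: mult.commute)
    qed
    ultimately show ?case
      by (intro exI[of _ "y * q"] exI[of _ "A * p"]) (simp add: y_def)
  qed
  then show ?thesis
    using C unfolding \<xi>_def by (intro exI[of _ "2 * C"]) auto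
qed

section \<open>The irrationality exponent\<close>

text \<open>Compare p/q with v/u for a suitable approximant. If they differ, 1 \<le> |u| |q \<xi> -
  p| + q |u \<xi> - v| with last term below 1/2; if they agree, the lower bound for |u \<xi> - v|
  transfers to p/q.\<close>

lemma cantor_number_diophantine_bound:
  fixes b :: int and N :: nat
  assumes b: "b \<ge> 2" and N: "N \<ge> 1"
  shows "\<exists>c>0. \<exists>q0. \<forall>q\<ge>q0. \<forall>p::int.
    c / real q powr (2 + 6 / N) \<le> \<bar>cantor_fun (1 / b) - p / real q\<bar>"
proof -
  define \<xi> where "\<xi> = cantor_fun (1 / b)"
  define approx where "approx = (\<lambda>C n m. \<exists>u v :: int.
     \<bar>real_of_int u\<bar> \<le> C * (real_of_int b ^ 3 ^ m) ^ (n + 1) \<and>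
     1 / (C * (real_of_int b ^ 3 ^ m) ^ (n + 1)) \<le> \<bar>u * \<xi> - v\<bar> \<and>
     \<bar>u * \<xi> - v\<bar> \<le> C / (real_of_int b ^ 3 ^ m) ^ n)"
  have "\<forall>n. \<exists>C>0. \<forall>\<^sub>F m in sequentially. approx C n m"
    using cantor_number_approximants[OF b] by (simp add: approx_def \<xi>_def)
  then obtain C where C: "\<And>n. C n > 0" "\<And>n. \<forall>\<^sub>F m in sequentially. approx (C n) n m"
    by metis
  \<comment> \<open>The degrees n = d + 2 with N \<le> d < 3N. As this set is finite, one constant
    \<open>K\<close> and one threshold \<open>m0\<close> serve all of them.\<close>
  define S where "S = {N + 2..3 * N + 1}"
  define K where "K = (\<Sum>n\<in>S. C n)"
  have CK: "C n \<le> K" if "n \<in> S" for n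
    unfolding K_def using that C(1) by (intro member_le_sum) (auto simp: S_def less_imp_le)
  have K: "K > 0"
    using CK[of "N + 2"] C(1)[of "N + 2"] N by (auto simp: S_def)
  have "\<forall>\<^sub>F m in sequentially. \<forall>n\<in>S. approx (C n) n m"
    by (rule eventually_ball_finite) (use C(2) in \<open>auto simp: S_def\<close>)
  moreover have "\<forall>\<^sub>F m in sequentially. real_of_int b ^ 3 ^ m > 2 * K"
    using filterlim_tower_at_top[OF b] by (simp add: filterlim_at_top_dense)
  ultimately have "\<forall>\<^sub>F m in sequentially. (\<forall>n\<in>S. approx (C n) n m) \<and> real_of_int b ^ 3 ^ m > 2 * K"
    by (rule eventually_conj)
  then obtain m0 where m0: "\<And>m n. m \<ge> m0 \<Longrightarrow> n \<in> S \<Longrightarrow> approx (C n) n m"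
     "\<And>m. m \<ge> m0 \<Longrightarrow> real_of_int b ^ 3 ^ m > 2 * K"
    unfolding eventually_sequentially by blast
  define \<beta> where "\<beta> = nat b"
  have \<beta>: "\<beta> \<ge> 2" "real_of_int b = real \<beta>"
    using b by (auto simp: \<beta>_def)
  \<comment> \<open>|u| is at most about y^(d + 3), with y^d \<le> q. The excess y^3 is at most
    q^(3/N), because y^N \<le> q.\<close>
  define s where "s = 3 / real N"
  have s: "s \<ge> 0"
    by (simp add: s_def)
  define c where "c = min (1 / (2 * K)) (1 / (K * K))"
  have c: "c > 0"
    using K by (simp add: c_def)
  have "c / real q powr (2 + 6 / N) \<le> \<bar>\<xi> - p / real q\<bar>" if q: "q \<ge> \<beta> ^ (3 ^ m0 * N)" for q and p :: int
  proof -
    have "q \<ge> 1"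
      using q \<beta> by (meson dual_order.trans one_le_numeral one_le_power)
    \<comment> \<open>\<open>m\<close> and \<open>n\<close> are chosen so that \<open>y ^ (n - 2) \<le> q < y ^ (n - 1)\<close> where \<open>y = b ^ 3 ^ m\<close>.\<close>
    obtain T where T: "\<beta> ^ T \<le> q" "q < \<beta> ^ (T + 1)"
      using ex_power_ivl1[OF \<beta>(1) \<open>q \<ge> 1\<close>] by blast
    have "\<beta> ^ (3 ^ m0 * N) < \<beta> ^ (T + 1)"
      using q T by linarith
    then have "3 ^ m0 * N < T + 1"
      using \<beta>(1) by (subst (asm) power_strict_increasing_iff) auto
    then have "3 ^ m0 * N \<le> T"
      by simp
    then have TN: "3 ^ m0 \<le> T div N"
      using N by (simp add: less_eq_div_iff_mult_less_eq)
    then have "T div N \<ge> 1"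
      using one_le_power[of "3::nat" m0] by linarith
    \<comment> \<open>Raising m by one cubes y, and d ranges over [N, 3N); so the ranges of T for
      successive m fit together without gaps.\<close>
    then obtain m where m: "3 ^ m \<le> T div N" "T div N < 3 ^ (m + 1)"
      using ex_power_ivl1[of 3 "T div N"] by auto
    have "(3::nat) ^ m0 < 3 ^ (m + 1)"
      using TN m by linarith
    then have "m0 < m + 1"
      by (subst (asm) power_strict_increasing_iff) auto
    then have "m \<ge> m0"
      by simp
    have mT: "3 ^ m * N \<le> T" "T < 3 ^ (m + 1) * N"
      using m N by (simp_all add: less_eq_div_iff_mult_less_eq div_less_iff_less_mult)
    define d where "d = T div 3 ^ m"
    define n where "n = d + 2"
    have "N \<le> d"
      unfolding d_def using mT(1) by (simp add: less_eq_div_iff_mult_less_eq mult.commute)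
    moreover have "d < 3 * N"
      unfolding d_def using mT(2) by (simp add: div_less_iff_less_mult mult.commute mult.left_commute)
    ultimately have "n \<in> S"
      by (simp add: n_def S_def)
    define y where "y = real \<beta> ^ 3 ^ m"
    have y: "y > 2 * K" "y > 0"
      using m0(2)[OF \<open>m \<ge> m0\<close>] \<beta> by (auto simp: y_def)
    obtain u v :: int where "\<bar>real_of_int u\<bar> \<le> C n * y ^ (n + 1)"
       "1 / (C n * y ^ (n + 1)) \<le> \<bar>u * \<xi> - v\<bar>" "\<bar>u * \<xi> - v\<bar> \<le> C n / y ^ n"
      using m0(1)[OF \<open>m \<ge> m0\<close> \<open>n \<in> S\<close>] unfolding approx_def \<beta>(2) y_def[symmetric] by blast
    moreover have "C n * y ^ (n + 1) \<le> K * y ^ (n + 1)" "C n / y ^ n \<le> K / y ^ n"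
      "1 / (K * y ^ (n + 1)) \<le> 1 / (C n * y ^ (n + 1))"
      using CK[OF \<open>n \<in> S\<close>] y C(1)[of n] K by (auto intro!: mult_right_mono divide_right_mono frac_le)
    ultimately have uv: "\<bar>real_of_int u\<bar> \<le> K * y ^ (n + 1)"
       "1 / (K * y ^ (n + 1)) \<le> \<bar>u * \<xi> - v\<bar>" "\<bar>u * \<xi> - v\<bar> \<le> K / y ^ n"
      by linarith+
    define r where "r = real q"
    have r: "r \<ge> 1"
      using \<open>q \<ge> 1\<close> by (simp add: r_def)
    have rT: "real \<beta> ^ T \<le> r" "r < real \<beta> ^ (T + 1)"
      using T unfolding r_def by (metis of_nat_le_iff of_nat_power, metis of_nat_less_iff of_nat_power)
    have yr: "r < y ^ (d + 1)"
    proof -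
      have "T + 1 \<le> 3 ^ m * (d + 1)"
        unfolding d_def using dividend_less_times_div[of "3 ^ m" T] by simp
      then have "real \<beta> ^ (T + 1) \<le> y ^ (d + 1)"
        unfolding y_def power_mult[symmetric] using \<beta> by (intro power_increasing) auto
      then show ?thesis
        using rT by linarith
    qed
    have small: "\<bar>u * \<xi> - v\<bar> < 1 / (2 * r)"
    proof -
      \<comment> \<open>The shift n = d + 2 leaves a spare factor y > 2K beyond r < y^(d +
        1).\<close>
      have "2 * K * r < y * y ^ (d + 1)"
        using y yr r K by (intro mult_strict_mono) auto
      then have "K / y ^ n < 1 / (2 * r)"
        using y r by (simp add: n_def field_simps)
      then show ?thesis
        using uv by linarith
    qed
    have large: "y ^ (n + 1) \<le> r powr (1 + s)"
    proof -
      have "y ^ d \<le> real \<beta> ^ T"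
        unfolding y_def power_mult[symmetric] d_def using \<beta> by (intro power_increasing) auto
      then have 1: "y ^ d \<le> r"
        using rT by linarith
      have "y ^ N \<le> real \<beta> ^ T"
        unfolding y_def power_mult[symmetric] using \<beta> mT by (intro power_increasing) auto
      then have "y powr N \<le> r"
        using rT y by (simp add: powr_realpow)
      then have "(y powr N) powr s \<le> r powr s"
        by (intro powr_mono2 s) auto
      then have "y ^ 3 \<le> r powr s"
        using N y by (simp add: powr_powr s_def)
      then have "y ^ d * y ^ 3 \<le> r * r powr s"
        using 1 y r by (intro mult_mono) auto
      then show ?thesis
        using r by (simp add: n_def powr_add eval_nat_numeral mult_ac)
    qed
    define X where "X = K * r powr (1 + s)"
    have X: "X > 0" "K * y ^ (n + 1) \<le> X"
      using K r large by (simp_all add: X_def)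
    have u: "\<bar>real_of_int u\<bar> \<le> X"
      using uv(1) X(2) by linarith
    have e: "1 / X \<le> \<bar>u * \<xi> - v\<bar>"
      using uv(2) X y K by (intro order_trans[OF _ uv(2)] frac_le) auto
    define t where "t = \<bar>r * \<xi> - p\<bar>"
    have pow: "r powr (1 + 2 * s) \<ge> r powr (1 + s)"
      using r s by (intro powr_mono) auto
    have "c / r powr (1 + 2 * s) \<le> t"
    proof (cases "int q * v = p * u")
      case True
      then have "r * v = p * real_of_int u"
        unfolding r_def by (metis of_int_mult of_int_of_nat_eq)
      then have "r * (u * \<xi> - v) = u * (r * \<xi> - p)"
        by (simp add: algebra_simps)
      from arg_cong[OF this, of abs] have "r * \<bar>u * \<xi> - v\<bar> = \<bar>real_of_int u\<bar> * t"
        using r by (simp add: abs_mult t_def)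
      then have "r * (1 / X) \<le> X * t"
        using e u r mult_left_mono[OF e, of r] mult_right_mono[OF u, of t] by (simp add: t_def)
      \<comment> \<open>This case sets the exponent: X is K r^(1 + s), so the bound is of order
        r^(-1 - 2s), and division by r gives 2 + 2s = 2 + 6/N.\<close>
      then have "r / (X * X) \<le> t"
        using X by (simp add: field_simps)
      moreover have "r powr (1 + 2 * s) = r powr 1 * (r powr s * r powr s)"
        by (simp only: mult_2 powr_add)
      then have "r / (X * X) = 1 / (K * K) / r powr (1 + 2 * s)"
        using r by (simp add: X_def powr_add[of r 1 s] field_simps)
      moreover have "c / r powr (1 + 2 * s) \<le> 1 / (K * K) / r powr (1 + 2 * s)"
        by (intro divide_right_mono) (auto simp: c_def)
      ultimately show ?thesis
        by linarith
    next
      case False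
      then have "1 \<le> \<bar>int q * v - p * u\<bar>"
        by linarith
      then have "1 \<le> \<bar>real_of_int (int q * v - p * u)\<bar>"
        by linarith
      also have "real_of_int (int q * v - p * u) = u * (r * \<xi> - p) - r * (u * \<xi> - v)"
        by (simp add: r_def algebra_simps)
      also have "\<bar>\<dots>\<bar> \<le> \<bar>real_of_int u\<bar> * t + r * \<bar>u * \<xi> - v\<bar>"
        using r abs_triangle_ineq4[of "u * (r * \<xi> - p)" "r * (u * \<xi> - v)"] by (simp add: t_def abs_mult)
      also have "\<dots> \<le> X * t + 1 / 2"
        using u mult_right_mono[OF u, of t] small r mult_strict_left_mono[OF small, of r]
        by (simp add: t_def)
      finally have "1 / (2 * X) \<le> t"
        using X by (simp add: field_simps)
      moreover have "c / r powr (1 + 2 * s) \<le> 1 / (2 * K) / r powr (1 + s)"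
        using pow r c K by (intro frac_le) (auto simp: c_def)
      ultimately show ?thesis
        by (simp add: X_def)
    qed
    then have "c / r powr (1 + 2 * s) / r \<le> t / r"
      using r by (intro divide_right_mono) auto
    moreover have "t / r = \<bar>\<xi> - p / r\<bar>"
    proof -
      have "\<xi> - p / r = (r * \<xi> - p) / r"
        using r by (simp add: field_simps)
      then show ?thesis
        using r by (simp add: t_def abs_divide)
    qed
    moreover have "2 + 6 / real N = (1 + 2 * s) + 1"
      by (simp add: s_def)
    then have "r powr (2 + 6 / real N) = r powr (1 + 2 * s) * r"
      using r by (simp only: powr_add[of r "1 + 2 * s" 1]) simp
    ultimately show ?thesis
      by (simp add: r_def)
  qed
  then show ?thesis
    using c unfolding \<xi>_def by blast
qed

text \<open>Dirichlet's theorem, transported from integer to natural denominators.\<close>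

lemma infinite_square_approximations:
  assumes "\<xi> \<notin> \<rat>"
  shows "infinite {(p::int, q::nat). q \<ge> 1 \<and> \<bar>\<xi> - p / real q\<bar> < 1 / real q powr 2}" (is "infinite ?S")
proof -
  have "approx_set \<xi> \<subseteq> (\<lambda>(p, q). (p, int q)) ` ?S"
  proof
    fix z assume "z \<in> approx_set \<xi>"
    then obtain h k where z: "z = (h, k)" "k > 0" "\<bar>\<xi> - of_int h / of_int k\<bar> < 1 / k\<^sup>2"
      by (auto simp: approx_set_def)
    then have "(h, nat k) \<in> ?S" "z = (h, int (nat k))"
      by auto
    then show "z \<in> (\<lambda>(p, q). (p, int q)) ` ?S"
      by force
  qed
  moreover have "infinite (approx_set \<xi>)"
    using assms rational_iff_finite_approx_set by blast
  ultimately show ?thesis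
    by (meson finite_imageI finite_subset)
qed

text \<open>Bounded q forces |p| \<le> M (|\<xi>| + 1), so infinitely many approximations need
  arbitrarily large denominators.\<close>

lemma finite_approximations_bounded_denominator:
  assumes "\<mu> \<ge> 0"
  shows "finite {(p::int, q::nat). 1 \<le> q \<and> q \<le> M \<and> \<bar>\<xi> - p / real q\<bar> < 1 / real q powr \<mu>}" (is "finite ?S")
proof (rule finite_subset)
  define B where "B = \<lceil>real M * (\<bar>\<xi>\<bar> + 1)\<rceil>"
  show "?S \<subseteq> {-B..B} \<times> {..M}"
  proof (rule subrelI)
    fix p :: int and q :: nat
    assume "(p, q) \<in> ?S"
    then have q: "1 \<le> q" "q \<le> M" and less: "\<bar>\<xi> - p / real q\<bar> < 1 / real q powr \<mu>"
      by auto
    have "1 / real q powr \<mu> \<le> 1"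
      using q assms by (simp add: ge_one_powr_ge_zero)
    then have "\<bar>p / real q\<bar> \<le> \<bar>\<xi>\<bar> + 1"
      using less by linarith
    then have "\<bar>real_of_int p\<bar> \<le> real q * (\<bar>\<xi>\<bar> + 1)"
      using q by (simp add: field_simps)
    also have "\<dots> \<le> real M * (\<bar>\<xi>\<bar> + 1)"
      using q by (intro mult_right_mono) auto
    finally have "\<bar>p\<bar> \<le> B"
      unfolding B_def by linarith
    then show "(p, q) \<in> {-B..B} \<times> {..M}"
      using q by auto
  qed
qed simp

theorem proposition4:
  fixes b :: int
  assumes "b \<ge> 2"
  shows "irrationality_exponent (\<Sum>k. real (cantor_seq k) / real_of_int b ^ k) = 2"
proof -
  define \<xi> where "\<xi> = cantor_fun (1 / b)"
  let ?S = "\<lambda>\<mu>. {(p::int, q::nat). q \<ge> 1 \<and> \<bar>\<xi> - p / real q\<bar> < 1 / real q powr \<mu>}"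
  have \<xi>: "(\<Sum>k. real (cantor_seq k) / real_of_int b ^ k) = \<xi>"
    by (simp add: \<xi>_def cantor_fun_def eval_fps_def divide_inverse power_inverse)
  have "irrationality_exponent \<xi> \<le> 2"
    unfolding irrationality_exponent_def
  proof (rule Sup_least, clarify)
    fix \<mu> :: real
    assume inf: "infinite (?S \<mu>)"
    show "ereal \<mu> \<le> 2"
    proof (rule ccontr)
      assume "\<not> ereal \<mu> \<le> 2"
      then have \<mu>: "\<mu> > 2"
        by simp
      obtain N :: nat where N: "6 / (\<mu> - 2) < real N"
        using reals_Archimedean2 by blast
      then have "real N > 0"
        using \<mu> by (smt (verit) divide_pos_pos)
      then have "N \<ge> 1"
        by simp
      define \<delta> where "\<delta> = \<mu> - (2 + 6 / N)"
      have "\<delta> > 0"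
        using N \<mu> \<open>real N > 0\<close> by (simp add: \<delta>_def field_simps)
      obtain c q0 where c: "c > 0"
        and bound: "\<And>q (p::int). q \<ge> q0 \<Longrightarrow> c / real q powr (2 + 6 / N) \<le> \<bar>\<xi> - p / real q\<bar>"
        using cantor_number_diophantine_bound[OF assms \<open>N \<ge> 1\<close>] unfolding \<xi>_def by blast
      \<comment> \<open>For q > M one has c q^\<delta> \<ge> 1, contradicting the two bounds on the
        distance.\<close>
      obtain M :: nat where M: "(1 / c) powr (1 / \<delta>) < real M"
        using reals_Archimedean2 by blast
      have "q \<le> max q0 M" if "q \<ge> 1" "\<bar>\<xi> - p / real q\<bar> < 1 / real q powr \<mu>" for p :: int and q
      proof (rule ccontr)
        assume "\<not> q \<le> max q0 M"
        then have q: "q \<ge> q0" "q > M"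
          by auto
        have "c / real q powr (2 + 6 / N) < 1 / real q powr \<mu>"
          using bound[OF q(1), of p] that by linarith
        moreover have "real q powr \<mu> = real q powr (2 + 6 / N) * real q powr \<delta>"
          by (simp add: \<delta>_def flip: powr_add)
        ultimately have "c * real q powr \<delta> < 1"
          using \<open>q \<ge> 1\<close> by (simp add: field_simps)
        moreover have "((1 / c) powr (1 / \<delta>)) powr \<delta> \<le> real q powr \<delta>"
          using q M \<open>\<delta> > 0\<close> by (intro powr_mono2) auto
        ultimately show False
          using c \<open>\<delta> > 0\<close> by (simp add: powr_powr field_simps)
      qed
      then have "?S \<mu> \<subseteq> {(p, q). 1 \<le> q \<and> q \<le> max q0 M \<and> \<bar>\<xi> - p / real q\<bar> < 1 / real q powr \<mu>}"
        by auto
      then show False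
        using inf finite_approximations_bounded_denominator[of \<mu> "max q0 M" \<xi>] \<mu> finite_subset by auto
    qed
  qed
  \<comment> \<open>A rational number has infinite exponent, so the upper bound already yields the
    irrationality that Dirichlet's theorem requires.\<close>
  moreover from this have "\<xi> \<notin> \<rat>"
    using irrationality_exponent_rational by force
  then have "ereal 2 \<le> irrationality_exponent \<xi>"
    unfolding irrationality_exponent_def
    by (intro Sup_upper imageI CollectI infinite_square_approximations)
  ultimately show ?thesis
    unfolding \<xi> by (simp add: order_antisym)
qed

end
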